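(* Let $n>0$ and $m>0$ be natural numbers. 1. For real numbers $r,s\in(0,1)$ with $r+s=1$, $$\sum_{i\geq0}\left[\left(\!\binom{n}{m+i}\!\right)s^i+\left(\!\binom{m}{n+i}\!\right)r^i\right]=\frac{1}{r^n\cdot s^m}.$$ 2. For natural numbers $N\geq n$ and $M\geq m$, $$\sum_{0\leq j\leq M-m}\left(\!\binom{n}{m+j}\!\right)\binom{N-n+M-m-j}{N-n}+\sum_{0\leq i\leq N-n}\left(\!\binom{m}{n+i}\!\right)\binom{N-n-i+M-m}{M-m}=\binom{N+M}{N}.$$ 3. For natural numbers $N>0$ and $M>0$, $$n\cdot\left(\!\binom{N}{n}\!\right)\cdot\sum_{j\geq m}\frac{\left(\!\binom{M}{j}\!\right)}{\left(\!\binom{n+j}{N+M}\!\right)}+m\cdot\left(\!\binom{M}{m}\!\right)\cdot\sum_{i\geq n}\frac{\left(\!\binom{N}{i}\!\right)}{\left(\!\binom{i+m}{N+M}\!\right)}=N+M.$$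
   Context: For natural numbers $n\geq1$ and $m\geq0$ the multichoose coefficient is $\left(\!\binom{n}{m}\!\right)=\binom{n+m-1}{m}=\frac{(n+m-1)!}{m!\,(n-1)!}$. The sums over $i\geq 0$, $j\geq m$, $i\geq n$ range over natural numbers and are infinite series. *)

theory Defs
  imports "HOL-Analysis.Analysis"
begin

(* Intended for n >= 1; there the truncated subtraction on nat is harmless. *)
definition multichoose :: "nat \<Rightarrow> nat \<Rightarrow> nat" where
  "multichoose n m = (n + m - 1) choose m"

lemma multichoose_fact:
  assumes "n \<ge> 1"
  shows "real (multichoose n m) = fact (n + m - 1) / (fact m * fact (n - 1))"
proof -
  have "m \<le> n + m - 1" and "n + m - 1 - m = n - 1"
    using assms by simp_all
  then show ?thesis
    unfolding multichoose_def by (simp only: binomial_fact)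
qed

end

theory Submission
  imports Defs
begin

text \<open>Assign to every lattice point \<open>(a, b)\<close> a weight with \<open>w(a, b) = w(a + 1, b) + w(a, b + 1)\<close>, read as the
  total weight of all words with a given prefix of \<open>a\<close> letters \<open>A\<close> and \<open>b\<close> letters \<open>B\<close>. There are
  \<open>multichoose n j\<close> prefixes ending in the \<open>n\<close>-th \<open>A\<close> and containing \<open>j\<close> letters \<open>B\<close>. In a word either
  the \<open>n\<close>-th \<open>A\<close> precedes the \<open>m\<close>-th \<open>B\<close> or conversely; this splits \<open>w(0, 0)\<close> as a finite sum over
  \<open>j < m\<close> and \<open>i < n\<close>. Since the full sum over all \<open>j\<close> (the position of the \<open>n\<close>-th \<open>A\<close>) is also
  \<open>w(0, 0)\<close>, and likewise for \<open>i\<close>, the two complementary tails also add up to \<open>w(0, 0)\<close>. The three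
  parts are the weights \<open>r^a s^b\<close>, \<open>binom(N - a + M - b, N - a)\<close> and the Beta function
  \<open>B(N + a, M + b)\<close>.\<close>

section \<open>Multichoose coefficients: special values, symmetry, Pascal rule\<close>

lemma multichoose_0_right [simp]: "multichoose n 0 = 1"
  by (simp add: multichoose_def)

lemma multichoose_Suc_0_left [simp]: "multichoose (Suc 0) k = 1"
  by (simp add: multichoose_def)

lemma multichoose_0_Suc [simp]: "multichoose 0 (Suc k) = 0"
  by (simp add: multichoose_def)

lemma multichoose_commute: "multichoose (Suc n) m = multichoose (Suc m) n"
  using binomial_symmetric[of m "n + m"] by (simp add: multichoose_def add.commute)

lemma multichoose_Suc_Suc:
  "multichoose (Suc n) (Suc k) = multichoose (Suc n) k + multichoose n (Suc k)"
  by (simp add: multichoose_def)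

lemma multichoose_mono_left: "n \<le> n' \<Longrightarrow> multichoose n k \<le> multichoose n' k"
  unfolding multichoose_def by (intro binomial_right_mono) auto

section \<open>Finite splitting of the total weight\<close>

text \<open>A word whose \<open>m\<close>-th B precedes its \<open>n\<close>-th A either has its
  \<open>Suc m\<close>-th B before that A as well, or reaches that A after exactly \<open>m\<close>
  letters B.\<close>

lemma lattice_weight_step:
  fixes w :: "nat \<Rightarrow> nat \<Rightarrow> 'a::comm_semiring_1"
  assumes "n > 0" and "\<And>a. a < n \<Longrightarrow> w a m = w (Suc a) m + w a (Suc m)"
  shows "(\<Sum>i<n. of_nat (multichoose (Suc m) i) * w i (Suc m)) + of_nat (multichoose n m) * w n m
       = (\<Sum>i<n. of_nat (multichoose m i) * w i m)"
  using assms
proof (induction n rule: nat_induct_non_zero)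
  case 1
  then show ?case by (simp add: add.commute)
next
  case (Suc n)
  obtain k where k: "n = Suc k"
    using \<open>n > 0\<close> by (auto simp: gr0_conv_Suc)
  \<comment> \<open>This symmetric form of Pascal's rule fails at \<open>n = m = 0\<close>, so the
    induction has to start at 1.\<close>
  have pascal: "multichoose (Suc n) m = multichoose n m + multichoose m n"
    using multichoose_Suc_Suc[of m k] multichoose_commute[of n m] multichoose_commute[of k m]
    by (simp add: k)
  let ?S = "\<Sum>i<n. of_nat (multichoose (Suc m) i) * w i (Suc m)"
  have "(\<Sum>i<Suc n. of_nat (multichoose (Suc m) i) * w i (Suc m))
          + of_nat (multichoose (Suc n) m) * w (Suc n) m
      = ?S + of_nat (multichoose (Suc n) m) * (w (Suc n) m + w n (Suc m))"
    by (simp add: multichoose_commute[of m n] algebra_simps)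
  also have "w (Suc n) m + w n (Suc m) = w n m"
    using Suc.prems[of n] by simp
  also have "?S + of_nat (multichoose (Suc n) m) * w n m
      = (?S + of_nat (multichoose n m) * w n m) + of_nat (multichoose m n) * w n m"
    by (simp add: pascal algebra_simps)
  also have "?S + of_nat (multichoose n m) * w n m = (\<Sum>i<n. of_nat (multichoose m i) * w i m)"
    using Suc by auto
  finally show ?case by simp
qed

text \<open>Induction on \<open>m\<close>, raising the height of the second sum by
  \<open>lattice_weight_step\<close>. The recursion is assumed only inside the box, which admits
  weights that violate it elsewhere.\<close>

lemma lattice_weight_split:
  fixes w :: "nat \<Rightarrow> nat \<Rightarrow> 'a::comm_semiring_1"
  assumes "n > 0" and "\<And>a b. a < n \<Longrightarrow> b < m \<Longrightarrow> w a b = w (Suc a) b + w a (Suc b)"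
  shows "(\<Sum>j<m. of_nat (multichoose n j) * w n j) + (\<Sum>i<n. of_nat (multichoose m i) * w i m) = w 0 0"
  using assms(2)
proof (induction m)
  case 0
  obtain k where "n = Suc k"
    using \<open>n > 0\<close> by (auto simp: gr0_conv_Suc)
  \<comment> \<open>With truncated subtraction \<open>multichoose 0 i\<close> is 1 at
    \<open>i = 0\<close> and 0 otherwise, so only \<open>w 0 0\<close> remains.\<close>
  then show ?case
    by (simp only: sum.lessThan_Suc_shift) simp
next
  case (Suc m)
  have "(\<Sum>j<Suc m. of_nat (multichoose n j) * w n j)
        + (\<Sum>i<n. of_nat (multichoose (Suc m) i) * w i (Suc m))
      = (\<Sum>j<m. of_nat (multichoose n j) * w n j)
        + ((\<Sum>i<n. of_nat (multichoose (Suc m) i) * w i (Suc m)) + of_nat (multichoose n m) * w n m)"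
    by (simp add: ac_simps)
  also have "\<dots> = (\<Sum>j<m. of_nat (multichoose n j) * w n j) + (\<Sum>i<n. of_nat (multichoose m i) * w i m)"
    using Suc.prems by (subst lattice_weight_step[OF \<open>n > 0\<close>]) auto
  also have "\<dots> = w 0 0"
    using Suc by simp
  finally show ?case .
qed

section \<open>Infinite series along a row\<close>

text \<open>\<open>vanish\<close> gives an endless run of B weight 0. It is demanded for
  \<open>a = 0\<close> only, because \<open>w a b\<close> is at most \<open>w 0 b\<close>.\<close>

locale lattice_weight =
  fixes w :: "nat \<Rightarrow> nat \<Rightarrow> real"
  assumes nonneg: "w a b \<ge> 0"
    and split: "w a b = w (Suc a) b + w a (Suc b)"
    and vanish: "w 0 \<longlonglongrightarrow> 0"
begin

lemma le_0_left: "w a b \<le> w 0 b"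
proof (induction a)
  case (Suc a)
  then show ?case using split[of a b] nonneg[of a "Suc b"] by linarith
qed simp

lemma row_vanish: "w a \<longlonglongrightarrow> 0"
  by (rule tendsto_sandwich[OF _ _ tendsto_const vanish]) (auto simp: nonneg le_0_left)

text \<open>The finite splitting bounds the partial sums by \<open>w 0 0\<close>, since its other
  part is nonnegative.\<close>

lemma summable_row:
  assumes "n > 0"
  shows "summable (\<lambda>j. real (multichoose n j) * w n j)"
proof (rule bounded_imp_summable)
  fix k
  have "(\<Sum>j<Suc k. real (multichoose n j) * w n j)
      + (\<Sum>i<n. real (multichoose (Suc k) i) * w i (Suc k)) = w 0 0"
    using assms by (intro lattice_weight_split split)
  moreover have "(\<Sum>i<n. real (multichoose (Suc k) i) * w i (Suc k)) \<ge> 0"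
    by (intro sum_nonneg) (simp add: nonneg)
  ultimately show "(\<Sum>j\<le>k. real (multichoose n j) * w n j) \<le> w 0 0"
    unfolding lessThan_Suc_atMost by linarith
qed (simp add: nonneg)

text \<open>By telescoping, \<open>w i m\<close> is the tail sum of \<open>w (i + 1) b\<close> over \<open>b \<ge> m\<close>, so the quantity below is
  dominated by a tail of the convergent series of row \<open>i + 1\<close>.\<close>
lemma multichoose_vanish: "(\<lambda>m. real (multichoose m i) * w i m) \<longlonglongrightarrow> 0"
proof (rule tendsto_sandwich[OF _ _ tendsto_const])
  let ?f = "\<lambda>b. real (multichoose (Suc i) b) * w (Suc i) b"
  show "(\<lambda>m. \<Sum>b. ?f (b + m)) \<longlonglongrightarrow> 0"
    by (rule suminf_exist_split2[OF summable_row]) simp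
  show "\<forall>\<^sub>F m in sequentially. real (multichoose m i) * w i m \<le> (\<Sum>b. ?f (b + m))"
  proof (rule always_eventually, rule allI)
    fix m
    have "(\<lambda>b. w i (b + m)) \<longlonglongrightarrow> 0"
      by (rule LIMSEQ_ignore_initial_segment[OF row_vanish])
    from telescope_sums'[OF this]
    have "(\<lambda>b. w i (b + m) - w i (Suc b + m)) sums w i m"
      by simp
    moreover have "w i (b + m) - w i (Suc b + m) = w (Suc i) (b + m)" for b
      using split[of i "b + m"] by simp
    ultimately have "(\<lambda>b. w (Suc i) (b + m)) sums w i m"
      by simp
    then have 1: "(\<lambda>b. real (multichoose m i) * w (Suc i) (b + m)) sums (real (multichoose m i) * w i m)"
      by (rule sums_mult)
    have 2: "(\<lambda>b. ?f (b + m)) sums (\<Sum>b. ?f (b + m))"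
      by (rule summable_sums[OF summable_ignore_initial_segment[OF summable_row]]) simp
    have "multichoose m i \<le> multichoose (Suc i) (b + m)" for b
      using multichoose_mono_left[of m "Suc (b + m)" i] multichoose_commute[of i "b + m"] by simp
    then show "real (multichoose m i) * w i m \<le> (\<Sum>b. ?f (b + m))"
      by (intro sums_le[OF _ 1 2] mult_right_mono nonneg) simp
  qed
qed (auto simp: nonneg)

text \<open>In the finite splitting at height \<open>m\<close> the other part has a fixed number
  \<open>n\<close> of terms, each tending to 0 as \<open>m\<close> grows.\<close>

lemma row_sums:
  assumes "n > 0"
  shows "(\<lambda>j. real (multichoose n j) * w n j) sums w 0 0"
proof -
  have "(\<lambda>m. w 0 0 - (\<Sum>i<n. real (multichoose m i) * w i m)) \<longlonglongrightarrow> w 0 0 - (\<Sum>i<n. 0)"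
    by (rule tendsto_diff[OF tendsto_const tendsto_sum[OF multichoose_vanish]])
  moreover have "w 0 0 - (\<Sum>i<n. real (multichoose m i) * w i m)
      = (\<Sum>j<m. real (multichoose n j) * w n j)" for m
    using lattice_weight_split[OF assms, of m w, OF split] by simp
  ultimately show ?thesis
    by (simp add: sums_def)
qed

lemma row_tail_has_sum:
  assumes "n > 0"
  shows "((\<lambda>j. real (multichoose n j) * w n j) has_sum
          (w 0 0 - (\<Sum>j<m. real (multichoose n j) * w n j))) {m..}"
proof -
  have "((\<lambda>j. real (multichoose n j) * w n j) has_sum w 0 0) UNIV"
    using row_sums[OF assms] by (intro sums_nonneg_imp_has_sum) (auto simp: nonneg)
  from has_sum_Diff[OF this has_sum_finite[of "{..<m}"]] show ?thesis
    by (simp add: Compl_eq_Diff_UNIV[symmetric] Compl_lessThan)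
qed

end

text \<open>Both full series equal \<open>w 0 0\<close>, and the initial sections cut off add up to
  \<open>w 0 0\<close>, which leaves \<open>2 * w 0 0 - w 0 0\<close>. The swapped weight is assumed
  separately because \<open>vanish\<close> concerns one direction only.\<close>

lemma lattice_weight_tails:
  fixes w :: "nat \<Rightarrow> nat \<Rightarrow> real"
  assumes "lattice_weight w" "lattice_weight (\<lambda>a b. w b a)" "n > 0" "m > 0"
  obtains x y where "((\<lambda>j. real (multichoose n j) * w n j) has_sum x) {m..}"
    "((\<lambda>i. real (multichoose m i) * w i m) has_sum y) {n..}" "x + y = w 0 0"
proof
  show "((\<lambda>j. real (multichoose n j) * w n j) has_sum
      (w 0 0 - (\<Sum>j<m. real (multichoose n j) * w n j))) {m..}"
    by (rule lattice_weight.row_tail_has_sum[OF assms(1,3)])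
  show "((\<lambda>i. real (multichoose m i) * w i m) has_sum
      (w 0 0 - (\<Sum>i<n. real (multichoose m i) * w i m))) {n..}"
    by (rule lattice_weight.row_tail_has_sum[OF assms(2,4)])
  show "w 0 0 - (\<Sum>j<m. real (multichoose n j) * w n j)
      + (w 0 0 - (\<Sum>i<n. real (multichoose m i) * w i m)) = w 0 0"
    using lattice_weight_split[OF assms(3), of m w, OF lattice_weight.split[OF assms(1)]] by simp
qed

section \<open>The three identities\<close>

text \<open>For independent letters with probabilities \<open>r\<close> and \<open>s\<close>, a
  prefix has weight \<open>r ^ a * s ^ b\<close> and the total is 1. All tail terms share the factor
  \<open>r ^ n * s ^ m\<close>, which is divided out.\<close>

lemma multichoose_geometric:
  fixes r s :: real
  assumes "n > 0" "m > 0" "0 < r" "0 < s" "r + s = 1"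
  shows "((\<lambda>i::nat. real (multichoose n (m + i)) * s ^ i + real (multichoose m (n + i)) * r ^ i)
          has_sum (1 / (r ^ n * s ^ m))) UNIV"
proof -
  have weight: "lattice_weight (\<lambda>a b. p ^ a * q ^ b)" if "0 < p" "0 < q" "p + q = 1" for p q :: real
  proof
    show "p ^ a * q ^ b = p ^ Suc a * q ^ b + p ^ a * q ^ Suc b" for a b
    proof -
      have "p ^ Suc a * q ^ b + p ^ a * q ^ Suc b = (p + q) * (p ^ a * q ^ b)"
        by (simp add: algebra_simps)
      then show ?thesis using that by simp
    qed
    show "(\<lambda>b. p ^ 0 * q ^ b) \<longlonglongrightarrow> 0"
      using that by (simp add: LIMSEQ_realpow_zero)
  qed (use that in auto)
  let ?w = "\<lambda>a b. r ^ a * s ^ b"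
  have "lattice_weight (\<lambda>a b. ?w b a)"
    using weight[of s r] assms by (simp add: mult.commute add.commute)
  then obtain x y where
    x: "((\<lambda>j. real (multichoose n j) * ?w n j) has_sum x) {m..}" and
    y: "((\<lambda>i. real (multichoose m i) * ?w i m) has_sum y) {n..}" and xy: "x + y = 1"
    using lattice_weight_tails[of ?w n m] weight[of r s] assms by auto
  have shift: "((\<lambda>i. f (k + i)) has_sum z) UNIV" if "(f has_sum z) {k..}"
    for f :: "nat \<Rightarrow> real" and k z
  proof -
    have "range (\<lambda>i. k + i) = {k..}"
      by (auto simp: image_iff le_iff_add)
    with that has_sum_reindex[of "\<lambda>i. k + i" UNIV f z] show ?thesis
      by (simp add: o_def)
  qed
  have "((\<lambda>i. real (multichoose n (m + i)) * ?w n (m + i)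
      + real (multichoose m (n + i)) * ?w (n + i) m) has_sum 1) UNIV"
    using has_sum_add[OF shift[OF x] shift[OF y]] by (simp add: xy)
  from has_sum_cmult_right[OF this, of "1 / (r ^ n * s ^ m)"]
  have "((\<lambda>i. 1 / (r ^ n * s ^ m) * (real (multichoose n (m + i)) * ?w n (m + i)
      + real (multichoose m (n + i)) * ?w (n + i) m)) has_sum 1 / (r ^ n * s ^ m)) UNIV"
    by simp
  moreover have "1 / (r ^ n * s ^ m) * (real (multichoose n (m + i)) * ?w n (m + i)
      + real (multichoose m (n + i)) * ?w (n + i) m)
      = real (multichoose n (m + i)) * s ^ i + real (multichoose m (n + i)) * r ^ i" for i
    using assms by (simp add: power_add field_simps)
  ultimately show ?thesis
    by (simp only:)
qed

text \<open>The weight counts lattice paths from \<open>(a, b)\<close> to \<open>(N, M)\<close>. It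
  is 0 outside the rectangle, so the full series are finite sums and no limit is involved.\<close>

lemma multichoose_binomial:
  assumes "n > 0" "m > 0" "n \<le> N" "m \<le> M"
  shows "(\<Sum>j = 0..M - m. multichoose n (m + j) * ((N - n + M - m - j) choose (N - n)))
        + (\<Sum>i = 0..N - n. multichoose m (n + i) * ((N - n - i + M - m) choose (M - m)))
        = (N + M) choose N"
proof -
  define w :: "nat \<Rightarrow> nat \<Rightarrow> nat"
    where "w = (\<lambda>a b. if a \<le> N \<and> b \<le> M then (N - a + (M - b)) choose (N - a) else 0)"
  text \<open>The recursion fails at \<open>(N, M)\<close> and only there among the points with nonzero weight.\<close>
  have rec: "w a b = w (Suc a) b + w a (Suc b)" if "a \<le> N" "b \<le> M" "a < N \<or> b < M" for a b
  proof -
    obtain k l where "N = a + k" "M = b + l"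
      using \<open>a \<le> N\<close> \<open>b \<le> M\<close> by (auto simp: le_iff_add)
    then show ?thesis
      using that by (cases k; cases l) (auto simp: w_def Suc_diff_le)
  qed
  have sum_ivl: "(\<Sum>j<Suc K. f j) = (\<Sum>j<k. f j) + (\<Sum>i = 0..K - k. f (k + i))"
    if "k \<le> K" for f :: "nat \<Rightarrow> nat" and k K
  proof -
    have "(\<Sum>j<Suc K. f j) = (\<Sum>j<k. f j) + (\<Sum>j=k..<Suc K. f j)"
      using that by (simp add: sum.atLeastLessThan_concat lessThan_atLeast0)
    also have "(\<Sum>j=k..<Suc K. f j) = (\<Sum>i = 0..K - k. f (k + i))"
      by (rule sum.reindex_bij_witness[of _ "\<lambda>i. k + i" "\<lambda>j. j - k"]) (use that in auto)
    finally show ?thesis .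
  qed
  let ?f = "\<lambda>j. multichoose n j * w n j" and ?g = "\<lambda>i. multichoose m i * w i m"
  \<comment> \<open>At height \<open>Suc M\<close> the other part of the splitting is 0, and
    \<open>a < n \<le> N\<close> keeps the recursion away from \<open>(N, M)\<close>.\<close>
  have "(\<Sum>j<Suc M. ?f j) + (\<Sum>i<n. multichoose (Suc M) i * w i (Suc M)) = w 0 0"
    using lattice_weight_split[of n "Suc M" w] assms rec by auto
  then have f: "(\<Sum>j<Suc M. ?f j) = w 0 0"
    by (simp add: w_def)
  have "(\<Sum>i<Suc N. ?g i) + (\<Sum>j<m. multichoose (Suc N) j * w (Suc N) j) = w 0 0"
    using lattice_weight_split[of m "Suc N" "\<lambda>a b. w b a"] assms rec by (auto simp: add.commute)
  then have g: "(\<Sum>i<Suc N. ?g i) = w 0 0"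
    by (simp add: w_def)
  have "(\<Sum>j<m. ?f j) + (\<Sum>i<n. ?g i) = w 0 0"
    using lattice_weight_split[of n m w] assms rec by auto
  then have "(\<Sum>j = 0..M - m. ?f (m + j)) + (\<Sum>i = 0..N - n. ?g (n + i)) = w 0 0"
    using f g sum_ivl[of m M ?f] sum_ivl[of n N ?g] assms by linarith
  also have "(\<Sum>j = 0..M - m. ?f (m + j))
      = (\<Sum>j = 0..M - m. multichoose n (m + j) * ((N - n + M - m - j) choose (N - n)))"
    using assms by (intro sum.cong) (auto simp: w_def add.assoc)
  also have "(\<Sum>i = 0..N - n. ?g (n + i))
      = (\<Sum>i = 0..N - n. multichoose m (n + i) * ((N - n - i + M - m) choose (M - m)))"
  proof (intro sum.cong refl)
    fix i assume "i \<in> {0..N - n}"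
    then show "?g (n + i) = multichoose m (n + i) * ((N - n - i + M - m) choose (M - m))"
      using assms binomial_symmetric[of "M - m" "N - n - i + (M - m)"] by (auto simp: w_def add.assoc)
  qed
  finally show ?thesis
    by (simp add: w_def)
qed

text \<open>\<open>beta_weight N M a b\<close> is the Beta function at \<open>(N + 1 + a, M + 1 + b)\<close>.\<close>
definition beta_weight :: "nat \<Rightarrow> nat \<Rightarrow> nat \<Rightarrow> nat \<Rightarrow> real" where
  "beta_weight N M a b = fact (N + a) * fact (M + b) / fact (Suc (N + M + a + b))"

lemma beta_weight_commute: "beta_weight N M a b = beta_weight M N b a"
  by (simp add: beta_weight_def ac_simps)

text \<open>The recursion is \<open>B(x, y) = B(x + 1, y) + B(x, y + 1)\<close>. The decay follows
  from \<open>fact (Suc (N + M + b))\<close> being at least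
  \<open>Suc b * fact (M + b)\<close>.\<close>

lemma lattice_weight_beta: "lattice_weight (beta_weight N M)"
proof
  show "beta_weight N M a b = beta_weight N M (Suc a) b + beta_weight N M a (Suc b)" for a b
  proof -
    define d :: real where "d = fact (Suc (N + M + a + b))"
    have "d > 0" by (simp add: d_def)
    have "fact (Suc (N + M + Suc a + b)) = real (Suc (Suc (N + M + a + b))) * d"
      "fact (Suc (N + M + a + Suc b)) = real (Suc (Suc (N + M + a + b))) * d"
      by (simp_all add: d_def)
    then show ?thesis
      unfolding beta_weight_def d_def[symmetric] using \<open>d > 0\<close>
      by (simp add: divide_simps del: of_nat_Suc) (simp add: algebra_simps)
  qed
  show "beta_weight N M 0 \<longlonglongrightarrow> 0"
  proof (rule tendsto_sandwich[OF _ _ tendsto_const])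
    show "(\<lambda>b. fact N * inverse (real (Suc b))) \<longlonglongrightarrow> 0"
      using tendsto_mult[OF tendsto_const LIMSEQ_inverse_real_of_nat] by simp
    show "\<forall>\<^sub>F b in sequentially. beta_weight N M 0 b \<le> fact N * inverse (real (Suc b))"
    proof (rule always_eventually, rule allI)
      fix b
      have "real (Suc b) * fact (M + b) \<le> fact (Suc (M + b))"
        by (simp add: mult_right_mono)
      also have "\<dots> \<le> fact (Suc (N + M + 0 + b))"
        by (rule fact_mono) simp
      finally have "fact N * (real (Suc b) * fact (M + b)) \<le> fact N * (fact (Suc (N + M + 0 + b)) :: real)"
        by (rule mult_left_mono) simp
      then show "beta_weight N M 0 b \<le> fact N * inverse (real (Suc b))"
        unfolding beta_weight_def by (simp add: divide_simps mult_ac del: of_nat_Suc fact_Suc)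
    qed
  qed (auto simp: beta_weight_def)
qed (simp add: beta_weight_def)

text \<open>Each term of the third identity is a Beta-weighted term up to a factor independent of
  \<open>j\<close>; in factorials both sides coincide, \<open>n\<close> turning
  \<open>fact n\<close> into \<open>fact (n - 1)\<close>.\<close>

lemma multichoose_quotient_eq_beta_weight:
  assumes "n > 0"
  shows "real n * real (multichoose (Suc N) n) *
      (real (multichoose (Suc M) j) / real (multichoose (n + j) (Suc N + Suc M)))
    = real (Suc N + Suc M) / beta_weight N M 0 0 * (real (multichoose n j) * beta_weight N M n j)"
proof -
  obtain k where k: "n = Suc k"
    using assms by (auto simp: gr0_conv_Suc)
  have "n + j + (Suc N + Suc M) - 1 = Suc (N + M + n + j)"
    by (simp add: k)
  moreover have "fact (Suc N + Suc M) = real (Suc N + Suc M) * fact (Suc (N + M))"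
    by simp
  moreover have "fact n = real n * fact k" "n - 1 = k" "n + j - 1 = k + j"
    by (simp_all add: k)
  moreover have "real n > 0" "real (Suc N + Suc M) > 0"
    using assms by simp_all
  ultimately show ?thesis
    using assms
    by (simp add: multichoose_fact beta_weight_def divide_simps ac_simps del: fact_Suc of_nat_Suc of_nat_add)
qed

lemma multichoose_beta:
  assumes "n > 0" "m > 0" "N > 0" "M > 0"
  defines "f \<equiv> \<lambda>j. real (multichoose M j) / real (multichoose (n + j) (N + M))"
    and "g \<equiv> \<lambda>i. real (multichoose N i) / real (multichoose (i + m) (N + M))"
  shows "f summable_on {m..}" "g summable_on {n..}"
    "real n * real (multichoose N n) * infsum f {m..}
      + real m * real (multichoose M m) * infsum g {n..} = real N + real M"
proof -
  obtain N' M' where N: "N = Suc N'" and M: "M = Suc M'"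
    using assms by (auto simp: gr0_conv_Suc)
  let ?w = "beta_weight N' M'"
  \<comment> \<open>Chosen so that the total weight \<open>?w 0 0\<close> is scaled to
    \<open>N + M\<close>.\<close>
  define c where "c = real (N + M) / ?w 0 0"
  define p where "p = real n * real (multichoose N n)"
  define q where "q = real m * real (multichoose M m)"
  have w0: "?w 0 0 > 0"
    by (simp add: beta_weight_def)
  have "multichoose N n > 0" "multichoose M m > 0"
    using assms by (auto simp: multichoose_def)
  then have pq: "p \<noteq> 0" "q \<noteq> 0"
    using assms by (auto simp: p_def q_def)
  have "p * f j = c * (real (multichoose n j) * ?w n j)" for j
    using multichoose_quotient_eq_beta_weight[OF assms(1)]
    unfolding f_def c_def p_def N M by blast
  then have f: "f j = c / p * (real (multichoose n j) * ?w n j)" for j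
    using pq by (simp add: eq_divide_eq mult.commute)
  have "q * g i = c * (real (multichoose m i) * ?w i m)" for i
    using multichoose_quotient_eq_beta_weight[OF assms(2), of M' N' i]
    unfolding g_def c_def q_def N M beta_weight_commute[of N' M']
    by (simp only: add.commute)
  then have g: "g i = c / q * (real (multichoose m i) * ?w i m)" for i
    using pq by (simp add: eq_divide_eq mult.commute)
  have swapped: "lattice_weight (\<lambda>a b. ?w b a)"
    using lattice_weight_beta[of M' N'] by (simp only: beta_weight_commute[of N' M'])
  obtain x y where x: "((\<lambda>j. real (multichoose n j) * ?w n j) has_sum x) {m..}"
    and y: "((\<lambda>i. real (multichoose m i) * ?w i m) has_sum y) {n..}" and xy: "x + y = ?w 0 0"
    by (rule lattice_weight_tails[OF lattice_weight_beta swapped assms(1,2)])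
  have fx: "(f has_sum (c / p * x)) {m..}"
    unfolding f[abs_def] by (rule has_sum_cmult_right[OF x])
  have gy: "(g has_sum (c / q * y)) {n..}"
    unfolding g[abs_def] by (rule has_sum_cmult_right[OF y])
  show "f summable_on {m..}" "g summable_on {n..}"
    using fx gy by (auto simp: summable_on_def)
  have "p * infsum f {m..} + q * infsum g {n..} = c * (x + y)"
    using infsumI[OF fx] infsumI[OF gy] pq by (simp add: field_simps)
  then show "real n * real (multichoose N n) * infsum f {m..}
      + real m * real (multichoose M m) * infsum g {n..} = real N + real M"
    using w0 xy by (simp add: c_def p_def q_def)
qed

theorem corollary16:
  fixes n m :: nat
  assumes "n > 0" and "m > 0"
  shows
    "(\<forall>r s :: real. 0 < r \<and> r < 1 \<and> 0 < s \<and> s < 1 \<and> r + s = 1 \<longrightarrow>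
        ((\<lambda>i::nat. real (multichoose n (m + i)) * s ^ i + real (multichoose m (n + i)) * r ^ i)
          has_sum (1 / (r ^ n * s ^ m))) UNIV)
     \<and>
     (\<forall>N M :: nat. N \<ge> n \<and> M \<ge> m \<longrightarrow>
        (\<Sum>j = 0..M - m. multichoose n (m + j) * ((N - n + M - m - j) choose (N - n)))
        + (\<Sum>i = 0..N - n. multichoose m (n + i) * ((N - n - i + M - m) choose (M - m)))
        = (N + M) choose N)
     \<and>
     (\<forall>N M :: nat. N > 0 \<and> M > 0 \<longrightarrow>
        (\<lambda>j. real (multichoose M j) / real (multichoose (n + j) (N + M))) summable_on {m..}
        \<and> (\<lambda>i. real (multichoose N i) / real (multichoose (i + m) (N + M))) summable_on {n..}
        \<and> real n * real (multichoose N n)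
            * (\<Sum>\<^sub>\<infinity>j\<in>{m..}. real (multichoose M j) / real (multichoose (n + j) (N + M)))
          + real m * real (multichoose M m)
            * (\<Sum>\<^sub>\<infinity>i\<in>{n..}. real (multichoose N i) / real (multichoose (i + m) (N + M)))
          = real N + real M)"
  using multichoose_geometric[OF assms] multichoose_binomial[OF assms] multichoose_beta[OF assms]
  by (intro conjI allI impI) auto

end
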